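(* Let $0<p<q$ be coprime integers, let $L_{(p,q)}=\mathbf{R}_{\ge 0}\cdot(p,q)$, and let $\alpha\in L_{(p,q)}\cap\mathbf{N}_0^2$. Then the walk which starts at $\alpha+(1,1)$ and at each step moves towards $L_{(p,q)}$ until reaching it, and the walk which starts at $(1,1)$ and at each step moves towards $L_{(p,q)}$ until reaching it, are given by the same sequence of elementary steps.
   Context: $\mathbf{N}_0=\{0,1,2,\dots\}$. Elementary steps are the unit vectors $(1,0)$ and $(0,1)$. Moving towards $L_{(p,q)}$ means: if the current point is strictly below $L_{(p,q)}$ the next step is $(0,1)$; if it is strictly above $L_{(p,q)}$ the next step is $(1,0)$; the walk stops the first time the current point lies on $L_{(p,q)}$. *)

theory Defs
  imports Complex_Main "HOL-Library.Product_Plus"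
begin

definition ray :: "int \<Rightarrow> int \<Rightarrow> (real \<times> real) set" where
  "ray p q = {(t * real_of_int p, t * real_of_int q) | t. t \<ge> 0}"

definition on_curve :: "nat \<times> nat \<Rightarrow> (real \<times> real) set \<Rightarrow> bool" where
  "on_curve a L \<longleftrightarrow> (real (fst a), real (snd a)) \<in> L"

text \<open>A point is compared with \<open>L\<close> along the vertical line through it. This is used for rays
  \<open>L = ray p q\<close> with \<open>p > 0\<close>, which meet every line \<open>x = c\<close> with \<open>c \<ge> 0\<close> in exactly one point.\<close>

definition strictly_below :: "nat \<times> nat \<Rightarrow> (real \<times> real) set \<Rightarrow> bool" where
  "strictly_below a L \<longleftrightarrow> (\<exists>y. (real (fst a), y) \<in> L \<and> real (snd a) < y)"

definition strictly_above :: "nat \<times> nat \<Rightarrow> (real \<times> real) set \<Rightarrow> bool" where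
  "strictly_above a L \<longleftrightarrow> (\<exists>y. (real (fst a), y) \<in> L \<and> y < real (snd a))"

text \<open>\<open>walk L a w\<close>: starting at \<open>a\<close> and always moving towards \<open>L\<close>, the walk reaches \<open>L\<close>, and \<open>w\<close>
  is the complete list of elementary steps taken up to the first visit to \<open>L\<close>.\<close>

inductive walk :: "(real \<times> real) set \<Rightarrow> nat \<times> nat \<Rightarrow> (nat \<times> nat) list \<Rightarrow> bool"
  for L :: "(real \<times> real) set" where
  stop: "on_curve a L \<Longrightarrow> walk L a []"
| up: "strictly_below a L \<Longrightarrow> walk L (a + (0, 1)) w \<Longrightarrow> walk L a ((0, 1) # w)"
| right: "strictly_above a L \<Longrightarrow> walk L (a + (1, 0)) w \<Longrightarrow> walk L a ((1, 0) # w)"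

end

theory Submission
  imports Defs "HOL-Number_Theory.Cong"
begin

text \<open>
  The defect \<open>q x - p y\<close> of a point \<open>(x, y)\<close> decides by its sign which step is taken, a step
  \<open>(0, 1)\<close> lowers it by \<open>p\<close> and a step \<open>(1, 0)\<close> raises it by \<open>q\<close>. So the steps depend only on the
  defect of the starting point, which is \<open>q - p\<close> for both walks. Modulo \<open>p + q\<close> either step
  subtracts \<open>p\<close>, and the defect stays strictly between \<open>-p\<close> and \<open>q\<close>; since
  \<open>q - p \<equiv> (p + q - 2) p\<close>, it must vanish after at most \<open>p + q - 2\<close> steps.
\<close>

definition defect :: "int \<Rightarrow> int \<Rightarrow> nat \<times> nat \<Rightarrow> int" where
  "defect p q a = q * int (fst a) - p * int (snd a)"

lemma defect_add [simp]: "defect p q (a + b) = defect p q a + defect p q b"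
  by (simp add: defect_def algebra_simps)

lemma defect_unit [simp]:
  "defect p q (0, Suc 0) = - p"
  "defect p q (Suc 0, 0) = q"
  by (simp_all add: defect_def)

text \<open>The first coordinate forces the parameter \<open>t = x / p\<close>. This presents the
  ray as a graph over \<open>0 \<le> x\<close>, so the existential heights in
  \<open>strictly_below\<close> and \<open>strictly_above\<close> collapse to one value.\<close>

lemma ray_iff:
  assumes "0 < p"
  shows "(x, y) \<in> ray p q \<longleftrightarrow> 0 \<le> x \<and> y = x * real_of_int q / real_of_int p"
proof
  assume "(x, y) \<in> ray p q"
  then show "0 \<le> x \<and> y = x * real_of_int q / real_of_int p"
    using assms by (auto simp: ray_def)
next
  assume "0 \<le> x \<and> y = x * real_of_int q / real_of_int p"
  then show "(x, y) \<in> ray p q"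
    using assms unfolding ray_def by (auto intro!: exI[of _ "x / real_of_int p"])
qed

lemma of_int_defect:
  "real_of_int (defect p q a) = real (fst a) * real_of_int q - real (snd a) * real_of_int p"
  by (simp add: defect_def algebra_simps)

lemma position_iff_defect:
  assumes "0 < p"
  shows on_curve_iff: "on_curve a (ray p q) \<longleftrightarrow> defect p q a = 0"
    and strictly_below_iff: "strictly_below a (ray p q) \<longleftrightarrow> 0 < defect p q a"
    and strictly_above_iff: "strictly_above a (ray p q) \<longleftrightarrow> defect p q a < 0"
proof -
  have p: "0 < real_of_int p"
    using assms by simp
  have "on_curve a (ray p q) \<longleftrightarrow> real_of_int (defect p q a) = 0"
    unfolding on_curve_def ray_iff[OF assms] of_int_defect using p by (auto simp: field_simps)
  then show "on_curve a (ray p q) \<longleftrightarrow> defect p q a = 0"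
    by simp
  have "strictly_below a (ray p q) \<longleftrightarrow>
      real (snd a) < real (fst a) * real_of_int q / real_of_int p"
    unfolding strictly_below_def ray_iff[OF assms] by simp
  also have "\<dots> \<longleftrightarrow> 0 < real_of_int (defect p q a)"
    unfolding of_int_defect using p by (simp add: pos_less_divide_eq)
  finally show "strictly_below a (ray p q) \<longleftrightarrow> 0 < defect p q a"
    by simp
  have "strictly_above a (ray p q) \<longleftrightarrow>
      real (fst a) * real_of_int q / real_of_int p < real (snd a)"
    unfolding strictly_above_def ray_iff[OF assms] by simp
  also have "\<dots> \<longleftrightarrow> real_of_int (defect p q a) < 0"
    unfolding of_int_defect using p by (simp add: pos_divide_less_eq)
  finally show "strictly_above a (ray p q) \<longleftrightarrow> defect p q a < 0"
    by simp
qed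

text \<open>Adding the same unit vector to \<open>a\<close> and \<open>b\<close> keeps their defects
  equal, so each rule used from \<open>a\<close> also applies from \<open>b\<close>.\<close>

lemma walk_cong_defect:
  assumes "0 < p" and "walk (ray p q) a w" and "defect p q a = defect p q b"
  shows "walk (ray p q) b w"
  using assms(2,3)
proof (induction arbitrary: b)
  case (stop a)
  then show ?case
    by (intro walk.stop) (simp add: on_curve_iff[OF assms(1)])
next
  case (up a w)
  then show ?case
    by (intro walk.up) (simp_all add: strictly_below_iff[OF assms(1)])
next
  case (right a w)
  then show ?case
    by (intro walk.right) (simp_all add: strictly_above_iff[OF assms(1)])
qed

text \<open>The guards of the three rules are zero, positive and negative defect, so inversion
  leaves only one rule.\<close>

lemma walk_unique:
  assumes "0 < p" and "walk (ray p q) a w" and "walk (ray p q) a w'"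
  shows "w' = w"
  using assms(2,3)
proof (induction arbitrary: w')
  case (stop a)
  from stop(2,1) show ?case
    by cases (simp_all add: position_iff_defect[OF assms(1)])
next
  case (up a w)
  from up.prems up.hyps(1) show ?case
    by cases (simp_all add: position_iff_defect[OF assms(1)] up.IH)
next
  case (right a w)
  from right.prems right.hyps(1) show ?case
    by cases (simp_all add: position_iff_defect[OF assms(1)] right.IH)
qed

text \<open>Here \<open>m\<close> bounds the number of remaining steps. The window from
  \<open>-p\<close> to \<open>q\<close> is invariant: \<open>p\<close> is subtracted only from a
  positive defect, \<open>q\<close> added only to a negative one. At \<open>m = 0\<close> it leaves
  0 as the only multiple of \<open>p + q\<close>.\<close>

lemma walk_exists:
  assumes "0 < p" and "0 < q"
    and "- p < defect p q a" and "defect p q a < q"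
    and "[defect p q a = int m * p] (mod (p + q))"
  shows "\<exists>w. walk (ray p q) a w"
  using assms(3-)
proof (induction m arbitrary: a)
  case 0
  then have "p + q dvd defect p q a"
    by (simp add: cong_0_iff)
  moreover have "\<bar>defect p q a\<bar> < p + q"
    using 0 assms(1,2) by linarith
  ultimately have "defect p q a = 0"
    by (meson abs_ge_self dvd_imp_le_int leD order_trans)
  then show ?case
    using walk.stop on_curve_iff[OF assms(1)] by blast
next
  case (Suc m)
  have down: "[defect p q a - p = int m * p] (mod (p + q))"
    using cong_diff[OF Suc.prems(3) cong_refl[of p]] by (simp add: algebra_simps)
  consider "defect p q a = 0" | "0 < defect p q a" | "defect p q a < 0"
    by linarith
  then show ?case
  proof cases
    case 1
    then show ?thesis
      using walk.stop on_curve_iff[OF assms(1)] by blast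
  next
    case 2
    then have "\<exists>w. walk (ray p q) (a + (0, 1)) w"
      using Suc.prems down assms(1) by (intro Suc.IH) simp_all
    then show ?thesis
      using 2 walk.up strictly_below_iff[OF assms(1)] by blast
  next
    case 3
    \<comment> \<open>Raising by \<open>q\<close> is lowering by \<open>p\<close> modulo
      \<open>p + q\<close>, so \<open>down\<close> serves this case too.\<close>
    have "[defect p q a + q = int m * p] (mod (p + q))"
      using cong_add[OF down, of "p + q" 0] by (simp add: cong_0_iff)
    then have "\<exists>w. walk (ray p q) (a + (1, 0)) w"
      using Suc.prems 3 assms(2) by (intro Suc.IH) simp_all
    then show ?thesis
      using 3 walk.right strictly_above_iff[OF assms(1)] by blast
  qed
qed

theorem corollary1:
  fixes p q :: int and \<alpha> :: "nat \<times> nat"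
  assumes "0 < p" and "p < q" and "coprime p q"
    and "on_curve \<alpha> (ray p q)"
  shows "\<exists>w. (\<forall>s. walk (ray p q) (\<alpha> + (1, 1)) s \<longleftrightarrow> s = w) \<and>
             (\<forall>s. walk (ray p q) (1, 1) s \<longleftrightarrow> s = w)"
proof -
  have start: "defect p q (1, 1) = q - p"
    by (simp add: defect_def)
  \<comment> \<open>The defect is additive and vanishes at \<open>\<alpha>\<close>.\<close>
  have same: "defect p q (1, 1) = defect p q (\<alpha> + (1, 1))"
    using assms(4) by (simp add: on_curve_iff[OF assms(1)])
  \<comment> \<open>The bound comes from \<open>q \<equiv> -p\<close>, whence
    \<open>q - p \<equiv> -2 * p\<close>; adding \<open>(p + q) * p\<close> makes the coefficient
    \<open>p + q - 2\<close>, which is nonnegative, so \<open>nat\<close> loses nothing.\<close>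
  have "(q - p) - int (nat (p + q - 2)) * p = (p + q) * (1 - p)"
    using assms(1,2) by (simp add: algebra_simps)
  then have "[defect p q (1, 1) = int (nat (p + q - 2)) * p] (mod (p + q))"
    unfolding start by (simp add: cong_iff_dvd_diff)
  then obtain w where w: "walk (ray p q) (1, 1) w"
    using walk_exists[OF assms(1), of q "(1, 1)"] assms(1,2) start by fastforce
  moreover from w have "walk (ray p q) (\<alpha> + (1, 1)) w"
    using walk_cong_defect[OF assms(1)] same by blast
  ultimately show ?thesis
    using walk_unique[OF assms(1)] by blast
qed

end
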